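(* Let $\mathscr{A}$ be an abelian $C^*$-algebra and let $\mathcal{E}$ be a Hilbert $\mathscr{A}$-module. If $T\in L(\mathcal{E})$, then $$\omega_{o}(T)\leq |||T||| \leq 2\,\omega_{o}(T).$$
   Context: A Hilbert $\mathscr{A}$-module $\mathcal{E}$ is a complex linear space and right $\mathscr{A}$-module with an $\mathscr{A}$-valued inner product $\langle\cdot,\cdot\rangle$ satisfying $\langle x,\alpha y+\beta z\rangle=\alpha\langle x,y\rangle+\beta\langle x,z\rangle$, $\langle x,ya\rangle=\langle x,y\rangle a$, $\langle x,y\rangle^*=\langle y,x\rangle$, $\langle x,x\rangle\ge 0$ with equality only if $x=0$ (for $x,y,z\in\mathcal{E}$, $a\in\mathscr{A}$, $\alpha,\beta\in\mathbb{C}$), complete in the norm $\|x\|=\|\langle x,x\rangle\|^{1/2}$. For $x\in\mathcal{E}$ put $|x|=\langle x,x\rangle^{1/2}\in\mathscr{A}$. $L(\mathcal{E})$ denotes the set of adjointable maps on $\mathcal{E}$: maps $T:\mathcal{E}\to\mathcal{E}$ for which there is $T^*:\mathcal{E}\to\mathcal{E}$ with $\langle Tx,y\rangle=\langle x,T^*y\rangle$ for all $x,y\in\mathcal{E}$ (such maps are automatically bounded and $\mathscr{A}$-linear). $\tau(\mathscr{A})$ is the set of characters of $\mathscr{A}$, i.e. nonzero $*$-homomorphisms $\varphi:\mathscr{A}\to\mathbb{C}$. For $T\in L(\mathcal{E})$ define $$|||T|||=\sup\{\varphi(|Tx|): x\in\mathcal{E},\ \varphi\in\tau(\mathscr{A}),\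 \varphi(|x|)=1\},$$ $$\omega_o(T)=\sup\{|\varphi(\langle Tx,x\rangle)|: x\in\mathcal{E},\ \varphi\in\tau(\mathscr{A}),\ \varphi(|x|)=1\}.$$ If $\mathcal{E}=\{0\}$ these sets are empty and the suprema are taken to be $0$. *)

theory Defs
  imports Complex_Main
begin

text \<open>C*-algebras, not necessarily unital and possibly zero. The ring, the norm and the
  underlying real scaling come from \<^class>\<open>real_normed_algebra\<close>, completeness from
  \<^class>\<open>complete_space\<close>.\<close>

class cstar_algebra = real_normed_algebra + complete_space +
  fixes scaleC :: "complex \<Rightarrow> 'a \<Rightarrow> 'a"  (infixr "*\<^sub>C" 75)
    and star :: "'a \<Rightarrow> 'a"
  assumes scaleR_scaleC: "r *\<^sub>R a = complex_of_real r *\<^sub>C a"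
    and scaleC_add_right: "c *\<^sub>C (a + b) = c *\<^sub>C a + c *\<^sub>C b"
    and scaleC_add_left: "(c + d) *\<^sub>C a = c *\<^sub>C a + d *\<^sub>C a"
    and scaleC_scaleC: "c *\<^sub>C d *\<^sub>C a = (c * d) *\<^sub>C a"
    and scaleC_one: "1 *\<^sub>C a = a"
    and mult_scaleC_left: "(c *\<^sub>C a) * b = c *\<^sub>C (a * b)"
    and mult_scaleC_right: "a * (c *\<^sub>C b) = c *\<^sub>C (a * b)"
    and norm_scaleC: "norm (c *\<^sub>C a) = cmod c * norm a"
    and star_star: "star (star a) = a"
    and star_add: "star (a + b) = star a + star b"
    and star_scaleC: "star (c *\<^sub>C a) = cnj c *\<^sub>C star a"
    and star_mult: "star (a * b) = star b * star a"
    and cstar_identity: "norm (star a * a) = (norm a)\<^sup>2"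

class abelian_cstar_algebra = cstar_algebra + comm_ring

definition cstar_positive :: "'a::cstar_algebra \<Rightarrow> bool"
  where "cstar_positive a \<longleftrightarrow> (\<exists>b. a = star b * b)"

text \<open>The positive square root; meaningful for positive arguments only.\<close>

definition cstar_sqrt :: "'a::cstar_algebra \<Rightarrow> 'a"
  where "cstar_sqrt a = (THE b. cstar_positive b \<and> b * b = a)"

definition characters :: "('a::cstar_algebra \<Rightarrow> complex) set"
  where "characters = {\<phi>.
    (\<forall>a b. \<phi> (a + b) = \<phi> a + \<phi> b) \<and>
    (\<forall>c a. \<phi> (c *\<^sub>C a) = c * \<phi> a) \<and>
    (\<forall>a b. \<phi> (a * b) = \<phi> a * \<phi> b) \<and>
    (\<forall>a. \<phi> (star a) = cnj (\<phi> a)) \<and>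
    (\<exists>a. \<phi> a \<noteq> 0)}"

definition module_norm :: "('e \<Rightarrow> 'e \<Rightarrow> 'a::cstar_algebra) \<Rightarrow> 'e \<Rightarrow> real"
  where "module_norm ip x = sqrt (norm (ip x x))"

definition module_abs :: "('e \<Rightarrow> 'e \<Rightarrow> 'a::cstar_algebra) \<Rightarrow> 'e \<Rightarrow> 'a"
  where "module_abs ip x = cstar_sqrt (ip x x)"

text \<open>The inner product is linear in its second argument. Compatibility of the two scalar
  actions, \<open>act (scale c x) a = scale c (act x a) = act x (c *\<^sub>C a)\<close>, is not listed because
  it follows from the inner product axioms.\<close>

locale hilbert_module = vector_space scale
  for scale :: "complex \<Rightarrow> 'e::ab_group_add \<Rightarrow> 'e" +
  fixes act :: "'e \<Rightarrow> 'a::cstar_algebra \<Rightarrow> 'e"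
    and ip :: "'e \<Rightarrow> 'e \<Rightarrow> 'a"
  assumes act_add_left: "act (x + y) a = act x a + act y a"
    and act_add_right: "act x (a + b) = act x a + act x b"
    and act_mult: "act x (a * b) = act (act x a) b"
    and ip_linear: "ip x (scale \<alpha> y + scale \<beta> z) = \<alpha> *\<^sub>C ip x y + \<beta> *\<^sub>C ip x z"
    and ip_act: "ip x (act y a) = ip x y * a"
    and ip_star: "star (ip x y) = ip y x"
    and ip_positive: "cstar_positive (ip x x)"
    and ip_definite: "ip x x = 0 \<Longrightarrow> x = 0"
    and module_complete:
      "(\<And>e. e > 0 \<Longrightarrow> \<exists>M. \<forall>m\<ge>M. \<forall>n\<ge>M. module_norm ip (X m - X n) < e)
        \<Longrightarrow> \<exists>L. (\<lambda>n. module_norm ip (X n - L)) \<longlonglongrightarrow> 0"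

definition adjointable :: "('e \<Rightarrow> 'e \<Rightarrow> 'a) \<Rightarrow> ('e \<Rightarrow> 'e) \<Rightarrow> bool"
  where "adjointable ip T \<longleftrightarrow> (\<exists>S. \<forall>x y. ip (T x) y = ip x (S y))"

text \<open>For adjointable maps of a Hilbert module over an abelian C*-algebra the sets below are
  bounded above, and they are empty only for the zero module. Since \<open>\<phi> (module_abs ip (T x))\<close>
  is then a nonnegative real, taking its real part only changes its type.\<close>

definition sup_or_zero :: "real set \<Rightarrow> real"
  where "sup_or_zero S = (if S = {} then 0 else Sup S)"

definition triple_norm :: "('e \<Rightarrow> 'e \<Rightarrow> 'a::cstar_algebra) \<Rightarrow> ('e \<Rightarrow> 'e) \<Rightarrow> real"
  where "triple_norm ip T =
    sup_or_zero {Re (\<phi> (module_abs ip (T x))) | x \<phi>. \<phi> \<in> characters \<and> \<phi> (module_abs ip x) = 1}"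

definition omega_o :: "('e \<Rightarrow> 'e \<Rightarrow> 'a::cstar_algebra) \<Rightarrow> ('e \<Rightarrow> 'e) \<Rightarrow> real"
  where "omega_o ip T =
    sup_or_zero {cmod (\<phi> (ip (T x) x)) | x \<phi>. \<phi> \<in> characters \<and> \<phi> (module_abs ip x) = 1}"

end

theory Submission
  imports Defs
begin

text \<open>Writing \<open>p\<close> for the seminorm \<open>x \<mapsto> sqrt (\<phi> (ip x x))\<close> of a character \<open>\<phi>\<close>, the value of
  \<open>\<phi>\<close> at \<open>|x|\<close> is \<open>p x\<close>. The lower estimate is then the Cauchy--Schwarz inequality, and the upper
  one the classical polarization argument for the form \<open>\<phi> (ip (T x) y)\<close>. What needs work is that
  \<open>|x|\<close> exists and that both suprema are finite. Gelfand theory is avoided: positive square roots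
  come from the iteration \<open>z \<mapsto> (y + z\<^sup>2) / 2\<close> for \<open>1 - sqrt (1 - y)\<close>, whose increments are
  dominated by those of the scalar iteration with \<open>y = 1\<close>, and which therefore converges even
  for \<open>norm y = 1\<close>. Finiteness of the suprema comes from uniform boundedness in the complete
  module, followed by log-convexity of the powers of the positive operator \<open>S \<circ> T\<close>, where
  \<open>S\<close> is the adjoint of \<open>T\<close>.\<close>

section \<open>Elementary rules for scalars, involution and norm\<close>

lemma scaleC_zero_left [simp]: "0 *\<^sub>C (a::'a::cstar_algebra) = 0"
  using scaleC_add_left[of 0 0 a] by simp

lemma scaleC_zero_right [simp]: "c *\<^sub>C (0::'a::cstar_algebra) = 0"
  using scaleC_add_right[of c 0 "0::'a"] by simp

lemma scaleC_minus_left: "(- c) *\<^sub>C (a::'a::cstar_algebra) = - (c *\<^sub>C a)"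
  using scaleC_add_left[of "- c" c a] by (simp add: eq_neg_iff_add_eq_0)

lemma scaleC_minus_right: "c *\<^sub>C (- a::'a::cstar_algebra) = - (c *\<^sub>C a)"
  using scaleC_add_right[of c "- a" a] by (simp add: eq_neg_iff_add_eq_0)

lemma scaleC_diff_right: "c *\<^sub>C (a - b::'a::cstar_algebra) = c *\<^sub>C a - c *\<^sub>C b"
  using scaleC_add_right[of c a "- b"] by (simp add: scaleC_minus_right)

lemma star_zero [simp]: "star (0::'a::cstar_algebra) = 0"
  using star_add[of 0 "0::'a"] by simp

lemma star_minus: "star (- a::'a::cstar_algebra) = - star a"
  using star_add[of "- a" a] by (simp add: eq_neg_iff_add_eq_0)

lemma star_diff: "star (a - b::'a::cstar_algebra) = star a - star b"
  using star_add[of a "- b"] by (simp add: star_minus)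

lemma star_scaleR: "star (r *\<^sub>R a::'a::cstar_algebra) = r *\<^sub>R star a"
  by (simp add: scaleR_scaleC star_scaleC)

lemma norm_star [simp]: "norm (star a) = norm (a::'a::cstar_algebra)"
proof -
  have le: "norm b \<le> norm (star b)" for b :: 'a
  proof (cases "b = 0")
    case False
    have "norm b * norm b \<le> norm (star b) * norm b"
      using norm_mult_ineq[of "star b" b] by (simp add: cstar_identity power2_eq_square)
    with False show ?thesis by simp
  qed simp
  from le[of a] le[of "star a"] show ?thesis by (simp add: star_star)
qed

lemma tendsto_star:
  fixes f :: "nat \<Rightarrow> 'a::cstar_algebra"
  assumes "f \<longlonglongrightarrow> a"
  shows "(\<lambda>n. star (f n)) \<longlonglongrightarrow> star a"
proof -
  have "bounded_linear (star :: 'a \<Rightarrow> 'a)"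
    by (rule bounded_linear_intro[where K = 1]) (simp_all add: star_add star_scaleR)
  from bounded_linear.tendsto[OF this assms] show ?thesis .
qed

text \<open>The test element \<open>star b\<close> and the C*-identity recover \<open>norm b\<close>
  from multiplication by \<open>b\<close>; this replaces evaluation at a unit.\<close>

lemma norm_le_mult_bound:
  fixes b :: "'a::cstar_algebra"
  assumes "\<And>x. norm (b * x) \<le> t * norm x" "0 \<le> t"
  shows "norm b \<le> t"
proof (cases "b = 0")
  case False
  have "norm b * norm b \<le> t * norm b"
    using assms(1)[of "star b"] cstar_identity[of "star b"] by (simp add: star_star power2_eq_square)
  with False show ?thesis by simp
qed (use assms in simp)

section \<open>The scalar iteration and convergence by domination\<close>

primrec sqrt_majorant :: "nat \<Rightarrow> real" where
  "sqrt_majorant 0 = 0"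
| "sqrt_majorant (Suc n) = (1 + (sqrt_majorant n)\<^sup>2) / 2"

lemma sqrt_majorant_bounds: "0 \<le> sqrt_majorant n" "sqrt_majorant n \<le> 1"
proof -
  have "0 \<le> sqrt_majorant n \<and> sqrt_majorant n \<le> 1"
    by (induction n) (auto intro: power_le_one)
  then show "0 \<le> sqrt_majorant n" "sqrt_majorant n \<le> 1" by auto
qed

text \<open>The increments of the iterations in the algebra factor in the same way, so bounds on the
  sum and the difference of two successive iterates propagate to the next difference.\<close>

lemma sqrt_majorant_diff:
  "sqrt_majorant (Suc (Suc n)) - sqrt_majorant (Suc n) =
    (sqrt_majorant (Suc n) - sqrt_majorant n) * ((sqrt_majorant (Suc n) + sqrt_majorant n) / 2)"
  by (simp add: field_simps power2_eq_square)

lemma sqrt_majorant_le_Suc: "sqrt_majorant n \<le> sqrt_majorant (Suc n)"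
proof -
  have "0 \<le> (1 - sqrt_majorant n)\<^sup>2" by simp
  then show ?thesis by (simp add: power2_eq_square algebra_simps)
qed

lemma sqrt_majorant_tendsto: "sqrt_majorant \<longlonglongrightarrow> 1"
proof -
  have "incseq sqrt_majorant" by (intro incseq_SucI sqrt_majorant_le_Suc)
  then obtain L where L: "sqrt_majorant \<longlonglongrightarrow> L"
    using incseq_convergent sqrt_majorant_bounds(2) by blast
  from L have "(\<lambda>n. sqrt_majorant (Suc n)) \<longlonglongrightarrow> (1 + L\<^sup>2) / 2"
    by (auto intro!: tendsto_intros)
  with L have "L = (1 + L\<^sup>2) / 2" using LIMSEQ_Suc LIMSEQ_unique by blast
  then have "(L - 1)\<^sup>2 = 0" by (simp add: power2_eq_square algebra_simps)
  with L show ?thesis by simp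
qed

text \<open>Telescoping bounds the tails of \<open>f\<close> by \<open>K\<close> times the tails of
  a convergent real sequence, so \<open>f\<close> is Cauchy.\<close>

lemma convergent_of_majorant:
  fixes f :: "nat \<Rightarrow> 'a::{real_normed_vector, complete_space}"
  assumes "\<And>n. norm (f (Suc n) - f n) \<le> K * (sqrt_majorant (Suc n) - sqrt_majorant n)"
  shows "convergent f"
proof -
  have step: "norm (f (m + k) - f m) \<le> K * (sqrt_majorant (m + k) - sqrt_majorant m)" for m k
  proof (induction k)
    case (Suc k)
    have "norm (f (m + Suc k) - f m) \<le> norm (f (Suc (m + k)) - f (m + k)) + norm (f (m + k) - f m)"
      using norm_triangle_ineq[of "f (Suc (m + k)) - f (m + k)" "f (m + k) - f m"] by simp
    also have "\<dots> \<le> K * (sqrt_majorant (Suc (m + k)) - sqrt_majorant (m + k))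
        + K * (sqrt_majorant (m + k) - sqrt_majorant m)"
      using assms[of "m + k"] Suc.IH by linarith
    finally show ?case by (simp only: add_Suc_right ring_distribs(1)[symmetric]) simp
  qed simp
  have "Cauchy (\<lambda>n. K * sqrt_majorant n)"
    by (intro LIMSEQ_imp_Cauchy[OF tendsto_mult_left[OF sqrt_majorant_tendsto]])
  have "Cauchy f"
  proof (rule CauchyI')
    fix e :: real assume "0 < e"
    with \<open>Cauchy (\<lambda>n. K * sqrt_majorant n)\<close> obtain M where
      M: "\<And>m n. m \<ge> M \<Longrightarrow> n \<ge> M \<Longrightarrow> norm (K * sqrt_majorant m - K * sqrt_majorant n) < e"
      using CauchyD by blast
    have "dist (f m) (f n) < e" if "m \<ge> M" "n > m" for m n
    proof -
      have "norm (f n - f m) \<le> K * sqrt_majorant n - K * sqrt_majorant m"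
        using step[of m "n - m"] that by (simp add: algebra_simps)
      also have "\<dots> < e" using M[of n m] that by auto
      finally show ?thesis by (simp add: dist_norm norm_minus_commute)
    qed
    then show "\<exists>M. \<forall>m\<ge>M. \<forall>n>m. dist (f m) (f n) < e" by blast
  qed
  then show ?thesis by (simp add: Cauchy_convergent_iff)
qed

section \<open>Square roots by iteration\<close>

text \<open>The equation for \<open>z\<close> says formally that \<open>(1 - z)^2 = 1 - v\<close>.
  Thus \<open>z\<close> stands for \<open>1 - sqrt (1 - v)\<close>, a form that needs no
  unit.\<close>

lemma exists_one_minus_sqrt:
  fixes v :: "'a::abelian_cstar_algebra"
  assumes "star v = v" "norm v \<le> 1"
  obtains z where "star z = z" "2 *\<^sub>R z = v + z * z"
proof -
  define z where "z = rec_nat 0 (\<lambda>_ z. (1/2) *\<^sub>R (v + z * z))"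
  have z0 [simp]: "z 0 = 0" and zS [simp]: "z (Suc n) = (1/2) *\<^sub>R (v + z n * z n)" for n
    by (simp_all add: z_def)
  have self: "star (z n) = z n" for n
    by (induction n) (simp_all add: star_scaleR star_add star_mult assms)
  have bound: "norm (z n) \<le> sqrt_majorant n" for n
  proof (induction n)
    case (Suc n)
    have "norm (z n * z n) \<le> (sqrt_majorant n)\<^sup>2"
      unfolding power2_eq_square
      by (rule order_trans[OF norm_mult_ineq]) (intro mult_mono Suc.IH norm_ge_zero sqrt_majorant_bounds)
    then show ?case using norm_triangle_ineq[of v "z n * z n"] assms(2) by simp
  qed simp
  have "norm (z (Suc n) - z n) \<le> sqrt_majorant (Suc n) - sqrt_majorant n" for n
  proof (induction n)
    case (Suc n)
    \<comment> \<open>Commutativity factors the difference of two squares, exactly as in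
      \<open>sqrt_majorant_diff\<close>.\<close>
    have "z (Suc (Suc n)) - z (Suc n) = (z (Suc n) - z n) * ((1/2) *\<^sub>R (z (Suc n) + z n))"
      unfolding zS[of "Suc n"] zS[of n, symmetric]
      by (subst (3) zS) (simp add: algebra_simps del: zS)
    also have "norm \<dots> \<le> (sqrt_majorant (Suc n) - sqrt_majorant n)
        * ((sqrt_majorant (Suc n) + sqrt_majorant n) / 2)"
    proof (rule order_trans[OF norm_mult_ineq], rule mult_mono)
      show "norm ((1/2) *\<^sub>R (z (Suc n) + z n)) \<le> (sqrt_majorant (Suc n) + sqrt_majorant n) / 2"
        using norm_triangle_ineq[of "z (Suc n)" "z n"] bound[of n] bound[of "Suc n"]
        by (simp del: zS sqrt_majorant.simps)
    qed (use Suc.IH sqrt_majorant_le_Suc[of n] in \<open>auto simp del: zS sqrt_majorant.simps\<close>)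
    finally show ?case by (simp only: sqrt_majorant_diff)
  qed (use assms in auto)
  then have "convergent z" by (intro convergent_of_majorant[where K = 1]) (simp del: zS)
  then obtain l where l: "z \<longlonglongrightarrow> l" by (auto simp: convergent_def)
  have "star l = l" using tendsto_star[OF l] l by (simp add: self LIMSEQ_unique)
  moreover have "(\<lambda>n. z (Suc n)) \<longlonglongrightarrow> (1/2) *\<^sub>R (v + l * l)"
    unfolding zS by (intro tendsto_intros l)
  then have "l = (1/2) *\<^sub>R (v + l * l)" using l LIMSEQ_Suc LIMSEQ_unique by blast
  then have "2 *\<^sub>R l = v + l * l" by (metis scaleR_half_double scaleR_2 scaleR_right_distrib)
  ultimately show ?thesis using that by blast
qed

text \<open>The hypothesis says \<open>norm (1 - h) \<le> 1\<close> without a unit: multiplication by \<open>1 - h\<close> is a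
  contraction. Likewise the iterates \<open>z\<close> approximating \<open>1 - sqrt h\<close> live in the unitization and are
  represented as \<open>sqrt_majorant n - b n\<close>, acting by multiplication.\<close>

lemma exists_sqrt:
  fixes h :: "'a::abelian_cstar_algebra"
  assumes "star h = h" and contr: "\<And>x. norm (x - h * x) \<le> norm x"
  obtains b where "star b = b" "b * b = h" "\<And>x. norm (x - b * x) \<le> norm x"
proof -
  \<comment> \<open>The recursion results from substituting \<open>sqrt_majorant n - b n\<close> for
    the iterate in \<open>z \<mapsto> ((1 - h) + z * z) / 2\<close> and separating off the scalar
    part.\<close>
  define b where "b = rec_nat 0 (\<lambda>n b. (1/2) *\<^sub>R (h + (2 * sqrt_majorant n) *\<^sub>R b - b * b))"
  define z where "z = (\<lambda>n x. sqrt_majorant n *\<^sub>R x - b n * x)"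
  have b0 [simp]: "b 0 = 0"
    and bS: "b (Suc n) = (1/2) *\<^sub>R (h + (2 * sqrt_majorant n) *\<^sub>R b n - b n * b n)" for n
    by (simp_all add: b_def)
  have self: "star (b n) = b n" for n
    by (induction n) (simp_all add: bS star_scaleR star_add star_diff star_mult assms)
  have zS: "z (Suc n) x = (1/2) *\<^sub>R ((x - h * x) + z n (z n x))" for n x
  proof -
    have half: "(r / 2) *\<^sub>R y + (r / 2) *\<^sub>R y = r *\<^sub>R y" for r and y :: 'a
      by (simp flip: scaleR_left_distrib)
    show ?thesis by (simp add: z_def bS algebra_simps power2_eq_square add_divide_distrib half)
  qed
  have z_add: "z n (x + y) = z n x + z n y" and z_diff: "z n (x - y) = z n x - z n y"
    and z_scale: "z n (r *\<^sub>R x) = r *\<^sub>R z n x" and z_comm: "z n (z m x) = z m (z n x)" for n m r x y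
    by (simp_all add: z_def algebra_simps)
  have bound: "norm (z n x) \<le> sqrt_majorant n * norm x" for n x
  proof (induction n arbitrary: x)
    case (Suc n)
    have "norm (z n (z n x)) \<le> sqrt_majorant n * (sqrt_majorant n * norm x)"
      by (rule order_trans[OF Suc.IH]) (intro mult_left_mono Suc.IH sqrt_majorant_bounds)
    then show ?case
      using norm_triangle_ineq[of "x - h * x" "z n (z n x)"] contr[of x]
      by (simp only: zS norm_scaleR) (simp add: power2_eq_square mult_ac ring_distribs)
  qed (simp add: z_def)
  have step: "norm (z (Suc n) x - z n x) \<le> (sqrt_majorant (Suc n) - sqrt_majorant n) * norm x" for n x
  proof (induction n arbitrary: x)
    case 0
    then show ?case
      using contr[of x]
      by (simp add: z_def bS algebra_simps norm_minus_commute flip: scaleR_diff_right)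
  next
    case (Suc n)
    define y where "y = (1/2) *\<^sub>R (z (Suc n) x + z n x)"
    have y_le: "norm y \<le> ((sqrt_majorant (Suc n) + sqrt_majorant n) / 2) * norm x"
      unfolding y_def norm_scaleR
      using norm_triangle_ineq[of "z (Suc n) x" "z n x"] bound[of n x] bound[of "Suc n" x]
      by (simp add: ring_distribs del: sqrt_majorant.simps)
    have "z (Suc (Suc n)) x - z (Suc n) x = (1/2) *\<^sub>R (z (Suc n) (z (Suc n) x) - z n (z n x))"
      by (subst zS, subst (3) zS) (simp add: algebra_simps)
    also have "\<dots> = z (Suc n) y - z n y"
      by (simp add: y_def z_add z_scale z_comm[of n "Suc n"] algebra_simps)
    also have "norm \<dots> \<le> (sqrt_majorant (Suc n) - sqrt_majorant n) * norm y" by (rule Suc.IH)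
    also have "\<dots> \<le> (sqrt_majorant (Suc n) - sqrt_majorant n)
        * (((sqrt_majorant (Suc n) + sqrt_majorant n) / 2) * norm x)"
      using y_le sqrt_majorant_le_Suc[of n]
      by (intro mult_left_mono) (simp_all del: sqrt_majorant.simps)
    finally show ?case by (simp only: sqrt_majorant_diff mult.assoc)
  qed
  \<comment> \<open>One scalar increment comes from \<open>sqrt_majorant\<close> itself and one from
    the bound on the increment of \<open>z\<close>, hence the factor 2.\<close>
  have "norm (b (Suc n) - b n) \<le> 2 * (sqrt_majorant (Suc n) - sqrt_majorant n)" for n
  proof (rule norm_le_mult_bound)
    fix x
    have "(b (Suc n) - b n) * x
        = (sqrt_majorant (Suc n) - sqrt_majorant n) *\<^sub>R x - (z (Suc n) x - z n x)"
      by (simp add: z_def algebra_simps del: sqrt_majorant.simps)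
    then show "norm ((b (Suc n) - b n) * x) \<le> 2 * (sqrt_majorant (Suc n) - sqrt_majorant n) * norm x"
      using norm_triangle_ineq4[of "(sqrt_majorant (Suc n) - sqrt_majorant n) *\<^sub>R x" "z (Suc n) x - z n x"]
        step[of n x] sqrt_majorant_le_Suc[of n]
      by (simp add: left_diff_distrib del: sqrt_majorant.simps)
  qed (use sqrt_majorant_le_Suc[of n] in simp)
  then have "convergent b" by (rule convergent_of_majorant)
  then obtain l where l: "b \<longlonglongrightarrow> l" by (auto simp: convergent_def)
  have "star l = l" using tendsto_star[OF l] l by (simp add: self LIMSEQ_unique)
  \<comment> \<open>The scalar part tends to 1, so the linear terms of the limit equation cancel and
    \<open>l * l = h\<close> remains.\<close>
  moreover have "(\<lambda>n. b (Suc n)) \<longlonglongrightarrow> (1/2) *\<^sub>R (h + (2 * 1) *\<^sub>R l - l * l)"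
    unfolding bS by (intro tendsto_intros l sqrt_majorant_tendsto)
  then have "l = (1/2) *\<^sub>R (h + (2 * 1) *\<^sub>R l - l * l)" using l LIMSEQ_Suc LIMSEQ_unique by blast
  then have "2 *\<^sub>R l = h + 2 *\<^sub>R l - l * l"
    by (metis mult_1_right scaleR_half_double scaleR_2 scaleR_right_distrib)
  then have "l * l = h" by (simp add: algebra_simps)
  \<comment> \<open>Keeping this property for the root allows a root of the root to be
    taken.\<close>
  moreover have "norm (x - l * x) \<le> norm x" for x
  proof (rule LIMSEQ_le)
    show "(\<lambda>n. norm (z n x)) \<longlonglongrightarrow> norm (x - l * x)"
      unfolding z_def using tendsto_scaleR[OF sqrt_majorant_tendsto tendsto_const[of x]] l
      by (auto intro!: tendsto_intros)
    show "(\<lambda>n. sqrt_majorant n * norm x) \<longlonglongrightarrow> norm x"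
      using tendsto_mult_right[OF sqrt_majorant_tendsto, of "norm x"] by simp
  qed (use bound in auto)
  ultimately show ?thesis using that by blast
qed

text \<open>With \<open>s = 1 - z\<close> and \<open>s\<^sup>2 + u\<^sup>2 = 1\<close>, the elements \<open>s \<plusminus> \<i> u\<close> are unitary, so their mean
  \<open>s\<close> is a contraction, and hence so is \<open>s\<^sup>2 = 1 - u\<^sup>2\<close>.\<close>

lemma norm_diff_square_mult_le:
  fixes u :: "'a::abelian_cstar_algebra"
  assumes u: "star u = u" and "norm u \<le> 1"
  shows "norm (x - u * u * x) \<le> norm x"
proof -
  have "norm (u * u) \<le> 1"
    using cstar_identity[of u] assms by (simp add: power_le_one)
  then obtain z where z: "star z = z" "2 *\<^sub>R z = u * u + z * z"
    using exists_one_minus_sqrt[of "u * u"] u by (auto simp: star_mult)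
  define s where "s = (\<lambda>x. x - z * x)"
  have ss: "s (s y) = y - u * u * y" for y
  proof -
    have "z * y + z * y = u * u * y + z * z * y"
      using arg_cong[OF z(2), of "\<lambda>t. t * y"] by (simp add: scaleR_2 distrib_right)
    then show ?thesis by (simp add: s_def algebra_simps)
  qed
  have unitary: "norm (s y + c *\<^sub>C (u * y)) = norm y" if c: "c = \<i> \<or> c = - \<i>" for c y
  proof -
    let ?w = "s y + c *\<^sub>C (u * y)"
    have "star ?w = s (star y) + cnj c *\<^sub>C (u * star y)"
      by (simp add: s_def star_add star_diff star_mult star_scaleC u z mult.commute)
    then have "star ?w * ?w = (s (star y) + cnj c *\<^sub>C (u * star y)) * ?w"
      by (rule arg_cong)
    also have "\<dots> = s (star y) * s y + (c + cnj c) *\<^sub>C (u * s (star y * y))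
        + (c * cnj c) *\<^sub>C (u * u * (star y * y))"
      by (simp add: s_def algebra_simps scaleC_add_left scaleC_add_right scaleC_diff_right
          mult_scaleC_left mult_scaleC_right scaleC_scaleC)
    \<comment> \<open>For both values, \<open>c + cnj c = 0\<close> and
      \<open>c * cnj c = 1\<close>, so the cross term disappears.\<close>
    also have "\<dots> = s (star y) * s y + u * u * (star y * y)"
      using c by (auto simp: scaleC_one)
    also have "s (star y) * s y = s (s (star y * y))" by (simp add: s_def algebra_simps)
    finally have "star ?w * ?w = star y * y" by (simp add: ss)
    then have "(norm ?w)\<^sup>2 = (norm y)\<^sup>2" by (simp flip: cstar_identity)
    then show ?thesis by simp
  qed
  have "norm (s y) \<le> norm y" for y
  proof -
    have "2 *\<^sub>R s y = (s y + \<i> *\<^sub>C (u * y)) + (s y + (- \<i>) *\<^sub>C (u * y))"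
      by (simp add: scaleC_minus_left scaleR_2)
    then have "norm (2 *\<^sub>R s y) \<le> norm y + norm y"
      using norm_triangle_ineq unitary by metis
    then show ?thesis by simp
  qed
  then show ?thesis by (metis ss order_trans)
qed

section \<open>Positive elements and their unique positive roots\<close>

text \<open>These are the real and imaginary parts of \<open>c\<close>; they commute, so the cross
  terms of \<open>star c * c\<close> cancel.\<close>

lemma self_adjoint_decomposition:
  fixes c :: "'a::abelian_cstar_algebra"
  obtains u v where "star u = u" "star v = v" "c = u + \<i> *\<^sub>C v"
    "norm u \<le> norm c" "norm v \<le> norm c" "star c * c = u * u + v * v"
proof
  let ?u = "(1/2) *\<^sub>C (c + star c)" and ?v = "(- \<i> / 2) *\<^sub>C (c - star c)"
  show "star ?u = ?u" by (simp add: star_scaleC star_add star_star add.commute)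
  show "star ?v = ?v"
  proof -
    have "(\<i> / 2) *\<^sub>C (star c - c) = (- (\<i> / 2)) *\<^sub>C (c - star c)"
      by (simp only: scaleC_minus_left) (simp flip: scaleC_minus_right)
    then show ?thesis by (simp add: star_scaleC star_diff star_star)
  qed
  show "norm ?u \<le> norm c" "norm ?v \<le> norm c"
    using norm_triangle_ineq[of c "star c"] norm_triangle_ineq4[of c "star c"]
    by (simp_all add: norm_scaleC norm_divide)
  have "c = (1/2 + 1/2) *\<^sub>C c" by (simp add: scaleC_one)
  then show c: "c = ?u + \<i> *\<^sub>C ?v"
    by (simp only: scaleC_add_left) (simp add: scaleC_scaleC scaleC_add_right scaleC_diff_right)
  have uv: "star c = ?u - \<i> *\<^sub>C ?v"
    using arg_cong[OF c, of star] \<open>star ?u = ?u\<close> \<open>star ?v = ?v\<close>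
    by (simp only: star_add star_scaleC[of "\<i>"]) (simp add: scaleC_minus_left)
  have "(p - \<i> *\<^sub>C q) * (p + \<i> *\<^sub>C q) = p * p + q * q" for p q :: 'a
    by (simp add: algebra_simps mult_scaleC_left mult_scaleC_right scaleC_scaleC scaleC_minus_left scaleC_one)
  with c uv show "star c * c = ?u * ?u + ?v * ?v" by metis
qed

lemma cstar_positive_scaleR:
  fixes a :: "'a::abelian_cstar_algebra"
  assumes "cstar_positive a" "0 \<le> r"
  shows "cstar_positive (r *\<^sub>R a)"
proof -
  from assms(1) obtain b where "a = star b * b" by (auto simp: cstar_positive_def)
  then have "r *\<^sub>R a = star (sqrt r *\<^sub>R b) * (sqrt r *\<^sub>R b)"
    using assms(2) by (simp add: star_scaleR)
  then show ?thesis unfolding cstar_positive_def by blast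
qed

lemma cstar_positive_star: "cstar_positive a \<Longrightarrow> star a = (a::'a::cstar_algebra)"
  by (auto simp: cstar_positive_def star_mult star_star)

lemma cstar_positive_sqrt_exists:
  fixes a :: "'a::abelian_cstar_algebra"
  assumes "cstar_positive a"
  obtains b where "cstar_positive b" "b * b = a"
proof -
  from assms obtain c where a: "a = star c * c" by (auto simp: cstar_positive_def)
  show ?thesis
  proof (cases "c = 0")
    case True
    then show ?thesis using that[of 0] a assms by simp
  next
    case False
    define d where "d = (1 / norm c) *\<^sub>R c"
    have "norm d = 1" using False by (simp add: d_def)
    then obtain u v where uv: "star u = u" "star v = v" "norm u \<le> 1" "norm v \<le> 1"
      "star d * d = u * u + v * v"
      using self_adjoint_decomposition[of d] by metis
    have "norm (x - ((1/2) *\<^sub>R (star d * d)) * x) \<le> norm x" for x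
    proof -
      \<comment> \<open>Multiplication by 1 minus the mean of \<open>u * u\<close> and
        \<open>v * v\<close> is the mean of two contractions; this is the reason for the factor
        1/2.\<close>
      have "x = (1/2) *\<^sub>R x + (1/2) *\<^sub>R x" by (simp flip: scaleR_left_distrib)
      then have "x - ((1/2) *\<^sub>R (star d * d)) * x
          = (1/2) *\<^sub>R (x - u * u * x) + (1/2) *\<^sub>R (x - v * v * x)"
        unfolding uv(5) by (simp add: algebra_simps)
      then show ?thesis
        using norm_triangle_ineq[of "(1/2) *\<^sub>R (x - u * u * x)" "(1/2) *\<^sub>R (x - v * v * x)"]
          norm_diff_square_mult_le[OF uv(1,3), of x] norm_diff_square_mult_le[OF uv(2,4), of x]
        by (simp only: norm_scaleR)
    qed
    moreover have "star ((1/2) *\<^sub>R (star d * d)) = (1/2) *\<^sub>R (star d * d)"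
      by (simp add: star_scaleR star_mult star_star)
    ultimately obtain b where b: "star b = b" "b * b = (1/2) *\<^sub>R (star d * d)"
      "\<And>x. norm (x - b * x) \<le> norm x"
      using exists_sqrt by metis
    \<comment> \<open>The root \<open>b\<close> is so far only self-adjoint; its own self-adjoint
      root \<open>e\<close> exhibits it as positive.\<close>
    obtain e where e: "star e = e" "e * e = b" using exists_sqrt[OF b(1,3)] by metis
    then have "cstar_positive b" by (metis cstar_positive_def)
    moreover have "a = (2 * (norm c)\<^sup>2) *\<^sub>R (b * b)"
      using False by (simp add: a b(2) d_def star_scaleR power2_eq_square)
    then have "((sqrt 2 * norm c) *\<^sub>R b) * ((sqrt 2 * norm c) *\<^sub>R b) = a"
      by (simp add: power2_eq_square algebra_simps)
    ultimately show ?thesis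
      using that cstar_positive_scaleR
      by (metis mult_nonneg_nonneg norm_ge_zero real_sqrt_ge_zero zero_le_numeral)
  qed
qed

text \<open>With positive roots \<open>p\<close> and \<open>q\<close>, the element
  \<open>w = p + \<i> q\<close> satisfies \<open>star w * w = a + b\<close>. Since \<open>p\<close>
  is the real part of \<open>w\<close>, its norm is at most \<open>norm w\<close>.\<close>

lemma cstar_positive_add:
  fixes a b :: "'a::abelian_cstar_algebra"
  assumes "cstar_positive a" "cstar_positive b"
  shows "cstar_positive (a + b)" and "norm a \<le> norm (a + b)"
proof -
  obtain p q where p: "cstar_positive p" "p * p = a" and q: "cstar_positive q" "q * q = b"
    using assms cstar_positive_sqrt_exists by metis
  note self = cstar_positive_star[OF p(1)] cstar_positive_star[OF q(1)]
  let ?w = "p + \<i> *\<^sub>C q"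
  have star_w: "star ?w = p - \<i> *\<^sub>C q"
    by (simp add: star_add star_scaleC self scaleC_minus_left)
  have w: "star ?w * ?w = a + b"
    unfolding star_w by (simp add: algebra_simps mult_scaleC_left mult_scaleC_right scaleC_scaleC scaleC_minus_left
        scaleC_one flip: p(2) q(2))
  then show "cstar_positive (a + b)" by (metis cstar_positive_def)
  have "2 *\<^sub>R p = ?w + star ?w" by (simp add: star_w scaleR_2)
  then have "norm (2 *\<^sub>R p) \<le> norm ?w + norm ?w" by (metis norm_triangle_ineq norm_star)
  then have "(norm p)\<^sup>2 \<le> (norm ?w)\<^sup>2" by simp
  then show "norm a \<le> norm (a + b)"
    using w p(2) self(1) cstar_identity by metis
qed

lemma cstar_positive_conjugate:
  fixes a g :: "'a::abelian_cstar_algebra"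
  assumes "cstar_positive a"
  shows "cstar_positive (star g * g * a)"
proof -
  from assms obtain b where "a = star b * b" by (auto simp: cstar_positive_def)
  then have "star g * g * a = star (b * g) * (b * g)" by (simp add: star_mult ac_simps)
  then show ?thesis by (auto simp: cstar_positive_def)
qed

text \<open>For \<open>g = b - d\<close>, the positive elements \<open>g * g * b\<close> and
  \<open>g * g * d\<close> sum to 0, so both vanish by monotonicity of the norm. Their difference is
  the cube of \<open>g\<close>, and the C*-identity, used twice on the fourth power, gives
  \<open>g = 0\<close>.\<close>

lemma cstar_positive_sqrt_unique:
  fixes b d :: "'a::abelian_cstar_algebra"
  assumes "cstar_positive b" "cstar_positive d" "b * b = d * d"
  shows "b = d"
proof -
  define g where "g = b - d"
  have g: "star g = g"
    using cstar_positive_star[OF assms(1)] cstar_positive_star[OF assms(2)] by (simp add: g_def star_diff)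
  have "g * g * b + g * g * d = g * (b * b - d * d)" by (simp add: g_def algebra_simps)
  then have "g * g * b + g * g * d = 0" using assms(3) by simp
  moreover have pos: "cstar_positive (g * g * b)" "cstar_positive (g * g * d)"
    using cstar_positive_conjugate[of _ g] assms g by simp_all
  ultimately have "g * g * b = 0" "g * g * d = 0"
    using cstar_positive_add(2)[OF pos] cstar_positive_add(2)[OF pos(2) pos(1)] by (simp_all add: add.commute)
  then have "g * g * g = 0" by (simp add: g_def algebra_simps)
  then have "star (g * g) * (g * g) = 0" by (simp add: star_mult g ac_simps)
  then have "star g * g = 0" using cstar_identity[of "g * g"] g by simp
  then have "g = 0" using cstar_identity[of g] by simp
  then show ?thesis by (simp add: g_def)
qed

lemma cstar_sqrt:
  fixes a :: "'a::abelian_cstar_algebra"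
  assumes "cstar_positive a"
  shows "cstar_positive (cstar_sqrt a)" "cstar_sqrt a * cstar_sqrt a = a"
proof -
  have "\<exists>!b. cstar_positive b \<and> b * b = a"
    using assms cstar_positive_sqrt_exists cstar_positive_sqrt_unique by metis
  from theI'[OF this] show "cstar_positive (cstar_sqrt a)" "cstar_sqrt a * cstar_sqrt a = a"
    by (simp_all add: cstar_sqrt_def)
qed

section \<open>Characters on positive elements\<close>

lemma charactersD:
  assumes "\<phi> \<in> characters"
  shows "\<phi> (a + b) = \<phi> a + \<phi> b" "\<phi> (c *\<^sub>C a) = c * \<phi> a" "\<phi> (a * b) = \<phi> a * \<phi> b"
    "\<phi> (star a) = cnj (\<phi> a)" "\<phi> (r *\<^sub>R a) = r * \<phi> a"
  using assms by (auto simp: characters_def scaleR_scaleC)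

lemma character_positive:
  assumes "\<phi> \<in> characters" "cstar_positive a"
  shows "\<phi> a = complex_of_real (Re (\<phi> a))" "0 \<le> Re (\<phi> a)"
proof -
  obtain b where "a = star b * b" using assms(2) by (auto simp: cstar_positive_def)
  then have "\<phi> a = complex_of_real ((cmod (\<phi> b))\<^sup>2)"
    by (simp only: charactersD[OF assms(1)] complex_norm_square) (simp add: mult.commute)
  then show "\<phi> a = complex_of_real (Re (\<phi> a))" "0 \<le> Re (\<phi> a)" by simp_all
qed

lemma character_cstar_sqrt:
  fixes a :: "'a::abelian_cstar_algebra"
  assumes "\<phi> \<in> characters" "cstar_positive a"
  shows "\<phi> (cstar_sqrt a) = complex_of_real (sqrt (Re (\<phi> a)))"
proof -
  note s = cstar_sqrt[OF assms(2)]
  define r where "r = Re (\<phi> (cstar_sqrt a))"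
  have r: "\<phi> (cstar_sqrt a) = complex_of_real r" "0 \<le> r"
    using character_positive[OF assms(1) s(1)] by (simp_all add: r_def)
  have "\<phi> a = \<phi> (cstar_sqrt a) * \<phi> (cstar_sqrt a)" using charactersD(3)[OF assms(1)] s(2) by metis
  then have "Re (\<phi> a) = r * r" by (simp add: r)
  then show ?thesis using r by simp
qed

text \<open>After normalization to \<open>v\<close>, the element \<open>z\<close> playing
  \<open>1 - sqrt (1 - v)\<close> has a real value \<open>r\<close> under \<open>\<phi>\<close>, and
  \<open>\<phi> v = 1 - (1 - r)^2\<close> is at most 1.\<close>

lemma character_positive_le_norm:
  fixes a :: "'a::abelian_cstar_algebra"
  assumes "\<phi> \<in> characters" "cstar_positive a"
  shows "Re (\<phi> a) \<le> norm a"
proof (cases "a = 0")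
  case True
  then show ?thesis using charactersD(1)[OF assms(1), of 0 0] by simp
next
  case False
  define v where "v = (1 / norm a) *\<^sub>R a"
  have "star v = v" "norm v \<le> 1"
    using False by (simp_all add: v_def star_scaleR cstar_positive_star[OF assms(2)])
  then obtain z where z: "star z = z" "2 *\<^sub>R z = v + z * z" by (rule exists_one_minus_sqrt)
  define r where "r = Re (\<phi> z)"
  have "cnj (\<phi> z) = \<phi> z" using charactersD(4)[OF assms(1), of z] z(1) by simp
  then have r: "\<phi> z = complex_of_real r" by (simp add: r_def complex_eq_iff)
  have "2 * \<phi> z = \<phi> v + \<phi> z * \<phi> z"
    using arg_cong[OF z(2), of \<phi>] by (simp add: charactersD[OF assms(1)])
  then have "\<phi> v = complex_of_real (2 * r - r * r)" by (simp add: r eq_diff_eq)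
  then have "Re (\<phi> v) = 1 - (1 - r)\<^sup>2" by (simp only: Re_complex_of_real) (simp add: power2_eq_square algebra_simps)
  then have "Re (\<phi> v) \<le> 1" by simp
  then show ?thesis using False by (simp add: v_def charactersD[OF assms(1)] divide_simps)
qed

section \<open>Three inequalities for real numbers\<close>

text \<open>The choice \<open>s = 1 / X\<close> is optimal; if \<open>X = 0\<close>, large
  \<open>s\<close> forces \<open>z = 0\<close>. The factor \<open>z\<close> in the quadratic term
  matches the Cauchy--Schwarz expansion, where \<open>z\<close> is the squared size of the inner
  product.\<close>

lemma le_mult_of_quadratic:
  fixes X Y z :: real
  assumes "\<And>s. 0 \<le> s \<Longrightarrow> 2 * s * z \<le> s\<^sup>2 * z * X + Y" "0 \<le> X" "0 \<le> Y" "0 \<le> z"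
  shows "z \<le> X * Y"
proof (cases "X = 0")
  case True
  have "z = 0"
  proof (rule ccontr)
    assume "z \<noteq> 0"
    then show False using assms(1)[of "(Y + 1) / z"] assms(2-) True by simp
  qed
  with True show ?thesis by simp
next
  case False
  then show ?thesis using assms(1)[of "1 / X"] assms(2-) by (simp add: field_simps power2_eq_square)
qed

text \<open>Log-convexity makes the successive ratios nondecreasing, so each is at least the first
  one, \<open>a 1\<close>.\<close>

lemma power_le_of_log_convex:
  fixes a :: "nat \<Rightarrow> real"
  assumes "\<And>n. 0 \<le> a n" "a 0 = 1" and convex: "\<And>n. (a (Suc n))\<^sup>2 \<le> a n * a (Suc (Suc n))"
  shows "a 1 ^ n \<le> a n"
proof (cases "a 1 = 0")
  case True
  with assms(1,2) show ?thesis by (cases n) simp_all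
next
  case False
  then have pos1: "0 < a 1" using assms(1)[of 1] by simp
  have step: "0 < a n \<and> a 1 * a n \<le> a (Suc n)" for n
  proof (induction n)
    case (Suc n)
    then have "0 < a (Suc n)" using pos1 by (meson mult_pos_pos less_le_trans)
    moreover have "a n * (a 1 * a (Suc n)) \<le> a n * a (Suc (Suc n))"
    proof -
      have "(a 1 * a n) * a (Suc n) \<le> a (Suc n) * a (Suc n)"
        using Suc.IH \<open>0 < a (Suc n)\<close> by (intro mult_right_mono) auto
      also have "\<dots> \<le> a n * a (Suc (Suc n))" using convex[of n] by (simp add: power2_eq_square)
      finally show ?thesis by (simp add: mult_ac)
    qed
    ultimately show ?case using Suc.IH by simp
  qed (use assms in simp)
  show ?thesis
  proof (induction n)
    case (Suc n)
    have "a 1 ^ Suc n \<le> a 1 * a n" using Suc.IH pos1 by simp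
    also have "\<dots> \<le> a (Suc n)" using step by blast
    finally show ?case .
  qed (use assms in simp)
qed

text \<open>Otherwise the powers of \<open>a / M\<close> would outgrow the constant
  \<open>c\<close>.\<close>

lemma le_of_power_le_mult_power:
  fixes a M c :: real
  assumes "0 < M" and "\<And>n. a ^ n \<le> c * M ^ n"
  shows "a \<le> M"
proof (rule ccontr)
  assume "\<not> a \<le> M"
  then have "1 < a / M" using assms(1) by simp
  then obtain n where "c < (a / M) ^ n" using real_arch_pow by blast
  then show False using assms(1) assms(2)[of n] by (simp add: power_divide field_simps)
qed

section \<open>Module norm, character seminorms and Cauchy--Schwarz\<close>

definition character_seminorm :: "('e \<Rightarrow> 'e \<Rightarrow> 'a::cstar_algebra) \<Rightarrow> ('a \<Rightarrow> complex) \<Rightarrow> 'e \<Rightarrow> real"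
  where "character_seminorm ip \<phi> x = sqrt (Re (\<phi> (ip x x)))"

locale abelian_hilbert_module = hilbert_module scale act ip
  for scale :: "complex \<Rightarrow> 'e::ab_group_add \<Rightarrow> 'e"
    and act :: "'e \<Rightarrow> 'a::abelian_cstar_algebra \<Rightarrow> 'e"
    and ip :: "'e \<Rightarrow> 'e \<Rightarrow> 'a"
begin

abbreviation "N \<equiv> module_norm ip"
abbreviation "p \<equiv> character_seminorm ip"

lemma ip_add_right: "ip x (y + z) = ip x y + ip x z"
  using ip_linear[of x 1 y 1 z] by (simp add: scaleC_one)

lemma ip_scale_right: "ip x (scale c y) = c *\<^sub>C ip x y"
  using ip_linear[of x c y 0 y] by simp

lemma ip_diff_right: "ip x (y - z) = ip x y - ip x z"
  using ip_linear[of x 1 y "-1" z] by (simp add: scaleC_one scaleC_minus_left)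

lemma ip_add_left: "ip (x + y) z = ip x z + ip y z"
  by (metis ip_add_right ip_star star_add)

lemma ip_scale_left: "ip (scale c x) y = cnj c *\<^sub>C ip x y"
  by (metis ip_scale_right ip_star star_scaleC)

lemma ip_diff_left: "ip (x - y) z = ip x z - ip y z"
  by (metis ip_diff_right ip_star star_diff)

lemma ip_act_left: "ip (act x a) y = star a * ip x y"
  by (metis ip_act ip_star star_mult)

lemma ip_left_cancel:
  assumes "\<And>y. ip x y = ip x' y"
  shows "x = x'"
  using ip_definite[of "x - x'"] assms by (simp add: ip_diff_left)

text \<open>The element is the inner square of \<open>act x a - y\<close> with
  \<open>a = s *\<^sub>R ip x y\<close>. It serves two Cauchy--Schwarz inequalities, one through the
  norm and one through a character.\<close>

lemma cauchy_schwarz_positive: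
  defines "Z \<equiv> \<lambda>x y. star (ip x y) * ip x y"
  shows "cstar_positive (s\<^sup>2 *\<^sub>R (Z x y * ip x x) - (2 * s) *\<^sub>R Z x y + ip y y)"
proof -
  define a where "a = s *\<^sub>R ip x y"
  have "ip (act x a - y) (act x a - y)
      = star a * (ip x x * a) - star a * ip x y - (ip y x * a - ip y y)"
    by (simp add: ip_diff_left ip_diff_right ip_act ip_act_left algebra_simps)
  also have "\<dots> = s\<^sup>2 *\<^sub>R (Z x y * ip x x) - (2 * s) *\<^sub>R Z x y + ip y y"
    unfolding Z_def ip_star a_def star_scaleR
    by (simp add: algebra_simps power2_eq_square scaleR_2 flip: scaleR_scaleR)
  finally show ?thesis using ip_positive by metis
qed

lemma norm_ip_le: "norm (ip x y) \<le> N x * N y"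
proof -
  let ?Z = "star (ip x y) * ip x y"
  have "(norm (ip x y))\<^sup>2 \<le> norm (ip x x) * norm (ip y y)"
  proof (rule le_mult_of_quadratic)
    fix s :: real assume "0 \<le> s"
    have "cstar_positive ?Z" by (auto simp: cstar_positive_def)
    then have "cstar_positive ((2 * s) *\<^sub>R ?Z)" using \<open>0 \<le> s\<close> by (simp add: cstar_positive_scaleR)
    \<comment> \<open>Adding the two positive elements cancels \<open>(2 * s) *\<^sub>R ?Z\<close>,
      and monotonicity of the norm bounds this term by the sum.\<close>
    from cstar_positive_add(2)[OF this cauchy_schwarz_positive[of s x y]]
    have "norm ((2 * s) *\<^sub>R ?Z) \<le> norm (s\<^sup>2 *\<^sub>R (?Z * ip x x) + ip y y)" by simp
    also have "\<dots> \<le> s\<^sup>2 * norm (?Z * ip x x) + norm (ip y y)"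
      by (rule order_trans[OF norm_triangle_ineq]) simp
    also have "\<dots> \<le> s\<^sup>2 * (norm ?Z * norm (ip x x)) + norm (ip y y)"
      by (intro add_right_mono mult_left_mono norm_mult_ineq) simp
    finally show "2 * s * (norm (ip x y))\<^sup>2 \<le> s\<^sup>2 * (norm (ip x y))\<^sup>2 * norm (ip x x) + norm (ip y y)"
      using \<open>0 \<le> s\<close> by (simp add: cstar_identity)
  qed simp_all
  then show ?thesis
    unfolding module_norm_def real_sqrt_mult[symmetric] by (rule real_le_rsqrt)
qed

lemma module_norm_nonneg [simp]: "0 \<le> N x"
  by (simp add: module_norm_def)

lemma module_norm_square: "(N x)\<^sup>2 = norm (ip x x)"
  by (simp add: module_norm_def)

lemma module_norm_scale: "N (scale c x) = cmod c * N x"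
  by (simp add: module_norm_def ip_scale_left ip_scale_right scaleC_scaleC norm_scaleC norm_mult
      real_sqrt_mult)

lemma module_norm_zero [simp]: "N 0 = 0"
  using module_norm_scale[of 0 0] by simp

lemma module_norm_minus_commute: "N (x - y) = N (y - x)"
  by (simp add: module_norm_def ip_diff_left ip_diff_right algebra_simps)

lemma module_norm_triangle: "N (x + y) \<le> N x + N y"
proof (rule power2_le_imp_le)
  have "ip (x + y) (x + y) = (ip x x + ip x y) + (ip y x + ip y y)"
    by (simp add: ip_add_left ip_add_right algebra_simps)
  then have "(N (x + y))\<^sup>2 \<le> (norm (ip x x) + norm (ip x y)) + (norm (ip y x) + norm (ip y y))"
    unfolding module_norm_square by (metis norm_triangle_mono norm_triangle_ineq)
  also have "\<dots> \<le> (N x + N y)\<^sup>2"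
    using norm_ip_le[of x y] norm_ip_le[of y x]
    by (simp add: power2_sum module_norm_square algebra_simps)
  finally show "(N (x + y))\<^sup>2 \<le> (N x + N y)\<^sup>2" .
qed simp

lemma character_seminorm_nonneg: "\<phi> \<in> characters \<Longrightarrow> 0 \<le> p \<phi> x"
  by (simp add: character_seminorm_def character_positive(2)[OF _ ip_positive])

lemma character_ip_self:
  "\<phi> \<in> characters \<Longrightarrow> \<phi> (ip x x) = complex_of_real ((p \<phi> x)\<^sup>2)"
  using character_positive[OF _ ip_positive[of x]] by (simp add: character_seminorm_def)

lemma character_module_abs: "\<phi> \<in> characters \<Longrightarrow> \<phi> (module_abs ip x) = complex_of_real (p \<phi> x)"
  by (simp add: character_seminorm_def module_abs_def character_cstar_sqrt ip_positive)

lemma character_seminorm_le_module_norm: "\<phi> \<in> characters \<Longrightarrow> p \<phi> x \<le> N x"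
  by (simp add: character_seminorm_def module_norm_def character_positive_le_norm ip_positive)

lemma character_seminorm_scale:
  assumes "\<phi> \<in> characters"
  shows "p \<phi> (scale c x) = cmod c * p \<phi> x"
proof -
  have "\<phi> (ip (scale c x) (scale c x)) = complex_of_real ((cmod c)\<^sup>2) * \<phi> (ip x x)"
    by (simp only: ip_scale_left ip_scale_right charactersD[OF assms] complex_norm_square mult_ac)
  then show ?thesis by (simp add: character_seminorm_def real_sqrt_mult)
qed

text \<open>A character turns the positive element of \<open>cauchy_schwarz_positive\<close> into a
  nonnegative real quadratic in \<open>s\<close>.\<close>

lemma cmod_character_ip_le:
  assumes \<phi>: "\<phi> \<in> characters"
  shows "cmod (\<phi> (ip x y)) \<le> p \<phi> x * p \<phi> y"
proof -
  note character_simps = charactersD[OF \<phi>]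
  have minus: "\<phi> (a - b) = \<phi> a - \<phi> b" for a b
    using character_simps(1)[of "a - b" b] by simp
  have Z: "\<phi> (star (ip x y) * ip x y) = complex_of_real ((cmod (\<phi> (ip x y)))\<^sup>2)"
    by (simp only: character_simps complex_norm_square) (simp add: mult.commute)
  have expand: "\<phi> (r *\<^sub>R (a * b) - t *\<^sub>R a + c) = r * (\<phi> a * \<phi> b) - t * \<phi> a + \<phi> c"
    for r t a b c
    by (simp add: character_simps minus)
  have "(cmod (\<phi> (ip x y)))\<^sup>2 \<le> (p \<phi> x)\<^sup>2 * (p \<phi> y)\<^sup>2"
  proof (rule le_mult_of_quadratic)
    fix s :: real
    show "2 * s * (cmod (\<phi> (ip x y)))\<^sup>2 \<le> s\<^sup>2 * (cmod (\<phi> (ip x y)))\<^sup>2 * (p \<phi> x)\<^sup>2 + (p \<phi> y)\<^sup>2"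
      using character_positive(2)[OF \<phi> cauchy_schwarz_positive[of s x y]]
      unfolding expand Z character_ip_self[OF \<phi>] by (simp add: mult_ac)
  qed simp_all
  then have "(cmod (\<phi> (ip x y)))\<^sup>2 \<le> (p \<phi> x * p \<phi> y)\<^sup>2" by (simp only: power_mult_distrib)
  then show ?thesis
    by (rule power2_le_imp_le) (intro mult_nonneg_nonneg character_seminorm_nonneg \<phi>)
qed

end

section \<open>Boundedness of adjointable operators\<close>

locale adjoint_pair = abelian_hilbert_module scale act ip
  for scale :: "complex \<Rightarrow> 'e::ab_group_add \<Rightarrow> 'e"
    and act :: "'e \<Rightarrow> 'a::abelian_cstar_algebra \<Rightarrow> 'e"
    and ip :: "'e \<Rightarrow> 'e \<Rightarrow> 'a" +
  fixes T S :: "'e \<Rightarrow> 'e"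
  assumes adjoint: "ip (T x) y = ip x (S y)"
begin

text \<open>Linearity of \<open>T\<close> is not an assumption; it follows from the adjoint relation
  because the inner product is nondegenerate.\<close>

lemma T_add: "T (x + y) = T x + T y"
  by (rule ip_left_cancel) (simp add: adjoint ip_add_left)

lemma T_scale: "T (scale c x) = scale c (T x)"
  by (rule ip_left_cancel) (simp add: adjoint ip_scale_left)

text \<open>Uniform boundedness by a gliding hump: if \<open>T\<close> is unbounded, the functionals
  \<open>ip (T (w n)) = (\<lambda>x. ip (w n) (S x))\<close> with \<open>N (T (w n)) > 4 ^ n * N (w n)\<close> are pointwise bounded
  after division by \<open>N (w n)\<close>, but the steps \<open>\<plusminus> v n\<close> of size \<open>3 ^ (-n)\<close>, with the sign chosen
  so that the functional stays large, lead to a point where they are not.\<close>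

lemma T_bounded:
  obtains M where "1 \<le> M" "\<And>x. N (T x) \<le> M * N x"
proof (cases "\<exists>M. \<forall>x. N (T x) \<le> M * N x")
  case True
  then obtain M where M: "\<And>x. N (T x) \<le> M * N x" by blast
  have "N (T x) \<le> max 1 M * N x" for x
    by (rule order_trans[OF M]) (simp add: mult_right_mono)
  then show ?thesis using that[of "max 1 M"] by simp
next
  case False
  then have "\<forall>n. \<exists>w. 4 ^ n * N w < N (T w)" by (meson not_le)
  then obtain w where w: "\<And>n::nat. 4 ^ n * N (w n) < N (T (w n))" by metis
  define f where "f n x = ip (T (w n)) x" for n x
  have Tw: "0 < N (T (w n))" for n
    using w[of n] by (meson module_norm_nonneg le_less_trans mult_nonneg_nonneg zero_le_power zero_le_numeral)
  have w_pos: "0 < N (w n)" for n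
  proof -
    have "N (T (w n)) * N (T (w n)) \<le> N (w n) * N (S (T (w n)))"
      using norm_ip_le[of "w n" "S (T (w n))"]
      by (simp add: adjoint[symmetric] module_norm_square[symmetric] power2_eq_square)
    then have "N (w n) \<noteq> 0" using Tw[of n] by (auto simp: mult_le_0_iff)
    then show ?thesis by (simp add: less_le)
  qed
  have f_add: "f n (x + y) = f n x + f n y" and f_diff: "f n (x - y) = f n x - f n y" for n x y
    by (simp_all add: f_def ip_add_right ip_diff_right)
  have f_le: "norm (f n x) \<le> N (T (w n)) * N x" for n x
    unfolding f_def by (rule norm_ip_le)
  define v where "v n = scale (complex_of_real ((1/3) ^ n / N (T (w n)))) (T (w n))" for n
  have v: "N (v n) = (1/3) ^ n" for n
    using Tw[of n] unfolding v_def module_norm_scale norm_of_real by simp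
  have fv: "norm (f n (v n)) = (1/3) ^ n * N (T (w n))" for n
    using Tw[of n] unfolding f_def v_def ip_scale_right norm_scaleC norm_of_real
    by (simp add: power2_eq_square flip: module_norm_square)
  define \<xi> where "\<xi> = rec_nat 0 (\<lambda>n x.
    if norm (f n (v n)) \<le> norm (f n (x + v n)) then x + v n else x - v n)"
  have \<xi>: "\<xi> (Suc n) = (if norm (f n (v n)) \<le> norm (f n (\<xi> n + v n)) then \<xi> n + v n else \<xi> n - v n)" for n
    by (simp add: \<xi>_def)
  have large: "norm (f n (v n)) \<le> norm (f n (\<xi> (Suc n)))" for n
  proof -
    \<comment> \<open>The values at \<open>\<xi> n + v n\<close> and \<open>\<xi> n - v n\<close>
      differ by twice \<open>f n (v n)\<close>, so they cannot both be smaller than it in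
      norm.\<close>
    have "norm (f n (v n)) \<le> norm (f n (\<xi> n - v n))" if "\<not> norm (f n (v n)) \<le> norm (f n (\<xi> n + v n))"
    proof -
      have "2 *\<^sub>R f n (v n) = f n (\<xi> n + v n) - f n (\<xi> n - v n)"
        by (simp add: f_add f_diff scaleR_2)
      then have "2 * norm (f n (v n)) \<le> norm (f n (\<xi> n + v n)) + norm (f n (\<xi> n - v n))"
        using norm_triangle_ineq4[of "f n (\<xi> n + v n)" "f n (\<xi> n - v n)"]
        by (metis norm_scaleR abs_numeral)
      with that show ?thesis by linarith
    qed
    then show ?thesis by (simp add: \<xi>)
  qed
  \<comment> \<open>The constant 3/2 is the sum of the geometric series with ratio 1/3.\<close>
  have dist: "N (\<xi> (n + k) - \<xi> n) \<le> (3/2) * ((1/3) ^ n - (1/3) ^ (n + k))" for n k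
  proof (induction k)
    case 0
    then show ?case by simp
  next
    case (Suc k)
    have "N (\<xi> (Suc m) - \<xi> m) = (1/3) ^ m" for m
      using module_norm_minus_commute[of "v m" 0] module_norm_minus_commute[of "\<xi> m" "\<xi> m - v m"]
      by (simp add: \<xi> v)
    then have "N (\<xi> (n + Suc k) - \<xi> n) \<le> (1/3) ^ (n + k) + N (\<xi> (n + k) - \<xi> n)"
      using module_norm_triangle[of "\<xi> (Suc (n + k)) - \<xi> (n + k)" "\<xi> (n + k) - \<xi> n"] by simp
    with Suc.IH show ?case by simp
  qed
  have dist': "N (\<xi> m - \<xi> n) \<le> (3/2) * (1/3) ^ n" if "n \<le> m" for m n
  proof -
    have "N (\<xi> m - \<xi> n) \<le> (3/2) * ((1/3) ^ n - (1/3) ^ m)"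
      using dist[of n "m - n"] that by simp
    also have "\<dots> \<le> (3/2) * (1/3) ^ n" by simp
    finally show ?thesis .
  qed
  have "\<exists>M. \<forall>m\<ge>M. \<forall>n\<ge>M. N (\<xi> m - \<xi> n) < e" if e: "0 < e" for e
  proof -
    obtain k :: nat where k: "(1/3) ^ k < e / 3"
      by (rule exE[OF real_arch_pow_inv[of "e / 3" "1/3"]]) (use e in simp_all)
    have "N (\<xi> m - \<xi> n) < e" if "m \<ge> k" "n \<ge> k" for m n
    proof -
      have "N (\<xi> m - \<xi> n) \<le> N (\<xi> m - \<xi> k) + N (\<xi> n - \<xi> k)"
        using module_norm_triangle[of "\<xi> m - \<xi> k" "\<xi> k - \<xi> n"]
        by (simp add: module_norm_minus_commute[of "\<xi> k"])
      then show ?thesis using dist'[of k m] dist'[of k n] that k by linarith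
    qed
    then show ?thesis by blast
  qed
  from module_complete[OF this] obtain L where L: "(\<lambda>n. N (\<xi> n - L)) \<longlonglongrightarrow> 0" by blast
  have lim: "N (\<xi> n - L) \<le> (3/2) * (1/3) ^ n" for n
  proof (rule LIMSEQ_le)
    show "(\<lambda>m. (3/2) * (1/3) ^ n + N (\<xi> m - L)) \<longlonglongrightarrow> (3/2) * (1/3) ^ n"
      using tendsto_add[OF tendsto_const L] by simp
    have "N (\<xi> n - L) \<le> (3/2) * (1/3) ^ n + N (\<xi> m - L)" if "m \<ge> n" for m
      using module_norm_triangle[of "\<xi> n - \<xi> m" "\<xi> m - L"] dist'[OF that]
      by (simp add: module_norm_minus_commute[of "\<xi> n" "\<xi> m"])
    then show "\<exists>k. \<forall>m\<ge>k. N (\<xi> n - L) \<le> (3/2) * (1/3) ^ n + N (\<xi> m - L)" by blast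
  qed (rule tendsto_const)
  have "(4/3) ^ n \<le> 2 * N (S L)" for n
  proof -
    have "(1/3) ^ n * N (T (w n)) \<le> norm (f n (\<xi> (Suc n)))"
      using large[of n] by (simp add: fv)
    also have "\<dots> \<le> norm (f n L) + norm (f n (\<xi> (Suc n) - L))"
      using norm_triangle_ineq[of "f n L" "f n (\<xi> (Suc n) - L)"] by (simp add: f_diff)
    \<comment> \<open>The tail after step \<open>Suc n\<close> takes at most half of the hump, as
      \<open>(3/2) * (1/3) = 1/2\<close>; absorbing it produces the factor 2 below.\<close>
    also have "norm (f n (\<xi> (Suc n) - L)) \<le> N (T (w n)) * ((3/2) * (1/3) ^ Suc n)"
      by (rule order_trans[OF f_le]) (intro mult_left_mono lim module_norm_nonneg)
    also have "norm (f n L) \<le> N (w n) * N (S L)"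
      unfolding f_def adjoint by (rule norm_ip_le)
    finally have "(1/3) ^ n * N (T (w n)) \<le> 2 * (N (w n) * N (S L))"
      by (simp add: mult.commute)
    moreover have "(1/3) ^ n * (4 ^ n * N (w n)) \<le> (1/3) ^ n * N (T (w n))"
      using w[of n] by (intro mult_left_mono) auto
    ultimately have "(1/3) ^ n * (4 ^ n * N (w n)) \<le> 2 * (N (w n) * N (S L))" by linarith
    then have "(4/3) ^ n * N (w n) \<le> (2 * N (S L)) * N (w n)"
      by (simp add: power_divide mult_ac)
    then show ?thesis using w_pos[of n] by simp
  qed
  moreover obtain n where "2 * N (S L) < (4/3) ^ n" using real_arch_pow[of "4/3"] by auto
  ultimately show ?thesis by (meson not_le)
qed

text \<open>The positive operator \<open>A = S \<circ> T\<close> satisfies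
  \<open>p \<phi> (A ^^ Suc n x)\<^sup>2 \<le> p \<phi> (A ^^ n x) * p \<phi> (A ^^ Suc (Suc n) x)\<close>, so its norm bound
  improves to a bound in the seminorm \<open>p \<phi>\<close> by passing to high powers.\<close>

lemma T_bounded_seminorm:
  obtains K where "\<And>\<phi> x. \<phi> \<in> characters \<Longrightarrow> p \<phi> x = 1 \<Longrightarrow> p \<phi> (T x) \<le> K"
proof -
  \<comment> \<open>The adjoint relation is symmetric, so \<open>T_bounded\<close> applies to
    \<open>S\<close> as well.\<close>
  interpret S: adjoint_pair scale act ip S T
    by unfold_locales (metis adjoint ip_star)
  obtain M1 where M1: "1 \<le> M1" "\<And>x. N (T x) \<le> M1 * N x" using T_bounded by blast
  obtain M2 where M2: "1 \<le> M2" "\<And>x. N (S x) \<le> M2 * N x" using S.T_bounded by blast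
  define A where "A = S \<circ> T"
  define M where "M = M2 * M1"
  have "1 \<le> M" using M1(1) M2(1) mult_mono[of 1 M2 1 M1] by (simp add: M_def)
  have A: "ip (A x) y = ip x (A y)" for x y
    by (simp add: A_def S.adjoint adjoint)
  have "N (A x) \<le> M * N x" for x
  proof -
    have "N (A x) \<le> M2 * N (T x)" by (simp add: A_def M2)
    also have "\<dots> \<le> M2 * (M1 * N x)" using M2(1) by (intro mult_left_mono M1) simp
    finally show ?thesis by (simp add: M_def mult_ac)
  qed
  then have A_power: "N ((A ^^ n) x) \<le> M ^ n * N x" for n x
  proof (induction n)
    case (Suc n)
    have "N ((A ^^ Suc n) x) \<le> M * N ((A ^^ n) x)" by (simp add: Suc.prems)
    also have "\<dots> \<le> M * (M ^ n * N x)" using Suc \<open>1 \<le> M\<close> by (intro mult_left_mono) auto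
    finally show ?case by (simp add: mult_ac)
  qed simp
  have "p \<phi> (T x) \<le> M" if \<phi>: "\<phi> \<in> characters" and x: "p \<phi> x = 1" for \<phi> x
  proof -
    define a where "a n = p \<phi> ((A ^^ n) x)" for n
    have "a 1 ^ n \<le> a n" for n
    proof (rule power_le_of_log_convex)
      fix n
      \<comment> \<open>Self-adjointness moves one factor \<open>A\<close> to the other side, after
        which Cauchy--Schwarz gives log-convexity.\<close>
      have "complex_of_real ((a (Suc n))\<^sup>2) = \<phi> (ip ((A ^^ n) x) ((A ^^ Suc (Suc n)) x))"
        unfolding a_def character_ip_self[OF \<phi>, symmetric] by (simp add: A)
      then have "(a (Suc n))\<^sup>2 = cmod (\<phi> (ip ((A ^^ n) x) ((A ^^ Suc (Suc n)) x)))"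
        by (metis norm_of_real abs_power2)
      also have "\<dots> \<le> a n * a (Suc (Suc n))" unfolding a_def by (rule cmod_character_ip_le[OF \<phi>])
      finally show "(a (Suc n))\<^sup>2 \<le> a n * a (Suc (Suc n))" .
    qed (simp_all add: a_def x character_seminorm_nonneg \<phi>)
    also have "a n \<le> N x * M ^ n" for n
      using character_seminorm_le_module_norm[OF \<phi>, of "(A ^^ n) x"] A_power[of n x]
      by (simp add: a_def mult.commute)
    \<comment> \<open>The factor \<open>N x\<close> does not depend on \<open>n\<close> and is lost
      in the comparison of powers.\<close>
    finally have "a 1 \<le> M"
      using \<open>1 \<le> M\<close> by (intro le_of_power_le_mult_power[of M "a 1" "N x"]) auto
    have "complex_of_real ((p \<phi> (T x))\<^sup>2) = \<phi> (ip x (A x))"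
      unfolding character_ip_self[OF \<phi>, symmetric] by (simp add: adjoint A_def)
    then have "(p \<phi> (T x))\<^sup>2 = cmod (\<phi> (ip x (A x)))" by (metis norm_of_real abs_power2)
    also have "\<dots> \<le> p \<phi> x * p \<phi> (A x)" by (rule cmod_character_ip_le[OF \<phi>])
    also have "\<dots> \<le> M" using \<open>a 1 \<le> M\<close> by (simp add: a_def x)
    also have "\<dots> \<le> M\<^sup>2" using \<open>1 \<le> M\<close> by (simp add: power2_eq_square)
    finally show ?thesis by (rule power2_le_imp_le) (use \<open>1 \<le> M\<close> in simp)
  qed
  then show ?thesis using that by blast
qed

section \<open>Polarization and the two estimates\<close>

text \<open>Averaging over the fourth roots of unity \<open>c\<close> isolates
  \<open>\<phi> (ip (T x) y)\<close> from the values of the quadratic form at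
  \<open>x + scale c y\<close>, while the squared seminorms at these four points add up by the
  parallelogram law.\<close>

lemma polarization:
  assumes \<phi>: "\<phi> \<in> characters"
    and W: "\<And>z. cmod (\<phi> (ip (T z) z)) \<le> W * (p \<phi> z)\<^sup>2"
  shows "cmod (\<phi> (ip (T x) y)) \<le> W * ((p \<phi> x)\<^sup>2 + (p \<phi> y)\<^sup>2)"
proof -
  define q where "q c = \<phi> (ip (T (x + scale c y)) (x + scale c y))" for c
  define r where "r c = (p \<phi> (x + scale c y))\<^sup>2" for c
  define B where "B x y = \<phi> (ip (T x) y)" for x y
  have q: "q c = B x x + c * B x y + cnj c * B y x + c * cnj c * B y y" for c
    by (simp add: q_def B_def T_add T_scale ip_add_left ip_add_right ip_scale_left ip_scale_right
        charactersD[OF \<phi>] algebra_simps)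
  have r: "complex_of_real (r c)
      = \<phi> (ip x x) + c * \<phi> (ip x y) + cnj c * \<phi> (ip y x) + c * cnj c * \<phi> (ip y y)" for c
    unfolding r_def character_ip_self[OF \<phi>, symmetric]
    by (simp add: ip_add_left ip_add_right ip_scale_left ip_scale_right
        charactersD[OF \<phi>] algebra_simps)
  have "complex_of_real (r 1 + r (-1) + r \<i> + r (-\<i>)) = 4 * (\<phi> (ip x x) + \<phi> (ip y y))"
    by (simp only: of_real_add r) simp
  also have "\<dots> = complex_of_real (4 * ((p \<phi> x)\<^sup>2 + (p \<phi> y)\<^sup>2))"
    by (simp add: character_ip_self[OF \<phi>])
  finally have r_sum: "r 1 + r (-1) + r \<i> + r (-\<i>) = 4 * ((p \<phi> x)\<^sup>2 + (p \<phi> y)\<^sup>2)"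
    using of_real_eq_iff by blast
  have q_le: "cmod (q c) \<le> W * r c" for c
    unfolding q_def r_def by (rule W)
  \<comment> \<open>The differences remove the terms even in \<open>c\<close>, and the factor
    \<open>- \<i>\<close> makes the two contributions of \<open>B y x\<close> cancel.\<close>
  have "4 * B x y = (q 1 - q (-1)) - \<i> * (q \<i> - q (-\<i>))"
    by (simp add: q algebra_simps)
  then have "cmod (4 * B x y) \<le> cmod (q 1 - q (-1)) + cmod (\<i> * (q \<i> - q (-\<i>)))"
    by (simp only: norm_triangle_ineq4)
  also have "\<dots> \<le> (cmod (q 1) + cmod (q (-1))) + (cmod (q \<i>) + cmod (q (-\<i>)))"
    unfolding norm_mult norm_ii mult_1_left by (intro add_mono norm_triangle_ineq4)
  also have "\<dots> \<le> W * (r 1 + r (-1) + r \<i> + r (-\<i>))"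
    using q_le[of 1] q_le[of "-1"] q_le[of \<i>] q_le[of "-\<i>"] by (simp add: algebra_simps)
  finally show ?thesis by (simp add: r_sum B_def norm_mult ring_distribs)
qed

text \<open>For the upper bound, polarization is applied to \<open>x\<close> and the normalized
  \<open>T x\<close>; both have seminorm 1, and the sum of their squares is the constant 2.\<close>

lemma omega_triple_inequalities:
  "omega_o ip T \<le> triple_norm ip T \<and> triple_norm ip T \<le> 2 * omega_o ip T"
proof -
  define I where "I = {(x, \<phi>). \<phi> \<in> characters \<and> p \<phi> x = 1}"
  define P where "P = (\<lambda>(x, \<phi>). p \<phi> (T x)) ` I"
  define Q where "Q = (\<lambda>(x, \<phi>). cmod (\<phi> (ip (T x) x))) ` I"
  have triple: "triple_norm ip T = sup_or_zero P"
    unfolding triple_norm_def P_def I_def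
    by (intro arg_cong[where f = sup_or_zero]) (force simp: character_module_abs)
  have omega: "omega_o ip T = sup_or_zero Q"
    unfolding omega_o_def Q_def I_def
    by (intro arg_cong[where f = sup_or_zero]) (force simp: character_module_abs)
  show ?thesis
  proof (cases "I = {}")
    case True
    then show ?thesis by (simp add: triple omega P_def Q_def sup_or_zero_def)
  next
    case False
    then have sups: "triple_norm ip T = Sup P" "omega_o ip T = Sup Q" and "P \<noteq> {}" "Q \<noteq> {}"
      by (simp_all add: triple omega P_def Q_def sup_or_zero_def)
    have QP: "cmod (\<phi> (ip (T x) x)) \<le> p \<phi> (T x)" if "\<phi> \<in> characters" "p \<phi> x = 1" for \<phi> x
      using cmod_character_ip_le[of \<phi> "T x" x] that by simp
    obtain K where K: "\<And>\<phi> x. \<phi> \<in> characters \<Longrightarrow> p \<phi> x = 1 \<Longrightarrow> p \<phi> (T x) \<le> K"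
      using T_bounded_seminorm by blast
    then have "bdd_above P" by (intro bdd_aboveI[of _ K]) (auto simp: P_def I_def)
    have "bdd_above Q"
      using order_trans[OF QP K] by (intro bdd_aboveI[of _ K]) (auto simp: Q_def I_def)
    have "Sup Q \<le> Sup P"
    proof (rule cSup_mono[OF \<open>Q \<noteq> {}\<close> \<open>bdd_above P\<close>])
      fix b assume "b \<in> Q"
      then show "\<exists>a\<in>P. b \<le> a" using QP by (force simp: P_def Q_def I_def)
    qed
    moreover have "Sup P \<le> 2 * Sup Q"
    proof (rule cSup_least[OF \<open>P \<noteq> {}\<close>])
      fix b assume "b \<in> P"
      then obtain x \<phi> where \<phi>: "\<phi> \<in> characters" and x: "p \<phi> x = 1" and b: "b = p \<phi> (T x)"
        by (auto simp: P_def I_def)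
      \<comment> \<open>Homogeneity extends the bound from seminorm 1 to every \<open>z\<close>; on
        the kernel of the seminorm, Cauchy--Schwarz makes the left side 0.\<close>
      have W: "cmod (\<phi> (ip (T z) z)) \<le> Sup Q * (p \<phi> z)\<^sup>2" for z
      proof (cases "p \<phi> z = 0")
        case True
        then show ?thesis using cmod_character_ip_le[OF \<phi>, of "T z" z] by simp
      next
        case False
        define t where "t = 1 / p \<phi> z"
        have t: "0 < t" using False character_seminorm_nonneg[OF \<phi>, of z] by (simp add: t_def)
        let ?z = "scale (complex_of_real t) z"
        have "p \<phi> ?z = 1" using False t unfolding character_seminorm_scale[OF \<phi>] norm_of_real by (simp add: t_def)
        then have "cmod (\<phi> (ip (T ?z) ?z)) \<le> Sup Q"
          using \<phi> by (intro cSup_upper \<open>bdd_above Q\<close>) (force simp: Q_def I_def)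
        moreover have "\<phi> (ip (T ?z) ?z) = complex_of_real (t\<^sup>2) * \<phi> (ip (T z) z)"
          by (simp add: T_scale ip_scale_left ip_scale_right charactersD[OF \<phi>] power2_eq_square)
        ultimately have "t\<^sup>2 * cmod (\<phi> (ip (T z) z)) \<le> Sup Q"
          by (simp only: norm_mult norm_of_real abs_power2)
        then show ?thesis using False by (simp add: t_def power_divide field_simps)
      qed
      show "b \<le> 2 * Sup Q"
      \<comment> \<open>Normalizing \<open>T x\<close> requires a nonzero seminorm; in the
        degenerate case nonnegativity of \<open>Sup Q\<close> suffices.\<close>
      proof (cases "b = 0")
        case True
        have "0 \<le> Sup Q" using order_trans[OF norm_ge_zero W[of x]] x by simp
        with True show ?thesis by simp
      next
        case False
        then have "0 < b" using character_seminorm_nonneg[OF \<phi>] by (simp add: b less_le)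
        let ?y = "scale (complex_of_real (1 / b)) (T x)"
        have "p \<phi> ?y = 1"
          using \<open>0 < b\<close> unfolding character_seminorm_scale[OF \<phi>] norm_of_real by (simp add: b)
        have "\<phi> (ip (T x) ?y) = complex_of_real (1 / b) * complex_of_real (b\<^sup>2)"
          unfolding ip_scale_right charactersD(2)[OF \<phi>] character_ip_self[OF \<phi>] b ..
        also have "\<dots> = complex_of_real b" using \<open>0 < b\<close> by (simp add: power2_eq_square)
        finally have "b = cmod (\<phi> (ip (T x) ?y))" using \<open>0 < b\<close> by simp
        also have "\<dots> \<le> Sup Q * ((p \<phi> x)\<^sup>2 + (p \<phi> ?y)\<^sup>2)" by (rule polarization[OF \<phi> W])
        finally show ?thesis using x \<open>p \<phi> ?y = 1\<close> by simp
      qed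
    qed
    ultimately show ?thesis by (simp add: sups)
  qed
qed

end

theorem theorem3p5:
  fixes scale :: "complex \<Rightarrow> 'e::ab_group_add \<Rightarrow> 'e"
    and act :: "'e \<Rightarrow> 'a::abelian_cstar_algebra \<Rightarrow> 'e"
    and ip :: "'e \<Rightarrow> 'e \<Rightarrow> 'a"
    and T :: "'e \<Rightarrow> 'e"
  assumes "hilbert_module scale act ip"
    and "adjointable ip T"
  shows "omega_o ip T \<le> triple_norm ip T \<and> triple_norm ip T \<le> 2 * omega_o ip T"
proof -
  obtain S where "\<And>x y. ip (T x) y = ip x (S y)"
    using assms(2) by (auto simp: adjointable_def)
  then interpret adjoint_pair scale act ip T S
    by (intro adjoint_pair.intro abelian_hilbert_module.intro adjoint_pair_axioms.intro assms(1))
  show ?thesis by (rule omega_triple_inequalities)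
qed

end
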